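(* Let $k=k(n)$ be an integer-valued function of $n$ with $k(n)\ge 2$ and $k(n)=o(\sqrt{n})$, and let $0<\beta < 1/2$. Let $c\ge 2$ (an integer) and $0<\varepsilon < 1/2$ be constants having the stability property described in the context, for $\alpha=1$ and this $\beta$. Then, for all large enough $n$, whenever $p$ is a prime, $A$ is a subset of $\mathbb{Z}_p$ with $|A|=n < (1 - \beta)p/2$, and $\mathcal{F} \subset A \times A$ satisfies $|\mathcal{F}|\le k(k-1)$ with $k=k(n)$, there is some $B'\subset A$ with $|B'|\le c$ such that $$|A+_{\mathcal{F}} B'|\ge 2n+1-2k.$$
   Context: $\mathbb{Z}_p$ is the cyclic group of prime order $p$. For $\mathcal{F}\subset A\times A$ (the set of forbidden pairs) and $B'\subset A$, the $\mathcal{F}$-restricted sum is $A+_{\mathcal{F}}B'=\{a+b : a\in A,\ b\in B',\ (a,b)\notin\mathcal{F}\}$. Stability property of $(c,\varepsilon)$ for given $\alpha,\beta>0$: for every prime $p$, all subsets $A,B$ of $\mathbb{Z}_p$ of size at least $2$ with $\alpha|B|\le|A|\le\alpha^{-1}|B|$ and $|A|+|B|\le(1-\beta)p$, and every integer $r\le\varepsilon|B|$, if $|A+\{b_1,\dots,b_c\}|\le |A|+|B|-1+r$ for any $c$ elements $b_1,\dots,b_c\in B$, then $B$ is contained in an arithmetic progression of size $|B|+r$ in $\mathbb{Z}_p$. (It is a theorem of the paper that for all $\alpha,\beta>0$ such constants $c$ and $\varepsilon>0$ exist.) *)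

theory Defs
  imports
    "HOL-Algebra.Elementary_Groups"
    "HOL-Computational_Algebra.Primes"
    "HOL-Library.Landau_Symbols"
begin

text \<open>
  The cyclic group of order \<open>p\<close> is the library's \<^const>\<open>integer_mod_group\<close>: its carrier is
  \<open>{0..<p}\<close> (as integers, for \<open>p > 0\<close>) and its operation, addition modulo \<open>p\<close>, is written
  multiplicatively. Hence the sumset \<open>A + B\<close> is the library's product set \<open>A <#> B\<close>,
  and the multiple \<open>i \<cdot> d\<close> is the power \<open>d [^] i\<close>.
\<close>

definition restricted_sum ::
    "('a, 'm) monoid_scheme \<Rightarrow> ('a \<times> 'a) set \<Rightarrow> 'a set \<Rightarrow> 'a set \<Rightarrow> 'a set" where
  "restricted_sum G F A B = {a \<otimes>\<^bsub>G\<^esub> b | a b. a \<in> A \<and> b \<in> B \<and> (a, b) \<notin> F}"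

text \<open>
  As the index bound is the cardinality of \<open>P\<close>, the listed terms are pairwise distinct:
  a progression of size \<open>m\<close> has exactly \<open>m\<close> elements, and \<open>P\<close> is necessarily finite.
\<close>

definition arithmetic_progression :: "('a, 'm) monoid_scheme \<Rightarrow> 'a set \<Rightarrow> bool" where
  "arithmetic_progression G P \<longleftrightarrow>
     (\<exists>a\<in>carrier G. \<exists>d\<in>carrier G. P = {a \<otimes>\<^bsub>G\<^esub> d [^]\<^bsub>G\<^esub> i | i::nat. i < card P})"

text \<open>
  The \<open>c\<close> elements \<open>b 1, \<dots>, b c\<close> of \<open>B\<close> need not be distinct. With distinct elements the
  condition on them would be vacuous for \<open>card B < c\<close>, forcing every such \<open>B\<close> into a short
  progression. The integer \<open>r\<close> may be negative.
\<close>

definition stability :: "real \<Rightarrow> real \<Rightarrow> nat \<Rightarrow> real \<Rightarrow> bool" where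
  "stability \<alpha> \<beta> c \<epsilon> \<longleftrightarrow>
     (\<forall>(p::nat) A B (r::int).
        prime p \<longrightarrow>
        A \<subseteq> carrier (integer_mod_group p) \<longrightarrow>
        B \<subseteq> carrier (integer_mod_group p) \<longrightarrow>
        2 \<le> card A \<longrightarrow> 2 \<le> card B \<longrightarrow>
        \<alpha> * real (card B) \<le> real (card A) \<longrightarrow>
        real (card A) \<le> inverse \<alpha> * real (card B) \<longrightarrow>
        real (card A) + real (card B) \<le> (1 - \<beta>) * real p \<longrightarrow>
        real_of_int r \<le> \<epsilon> * real (card B) \<longrightarrow>
        (\<forall>b \<in> {1..c} \<rightarrow> B.
           int (card (A <#>\<^bsub>integer_mod_group p\<^esub> (b ` {1..c})))
             \<le> int (card A) + int (card B) - 1 + r) \<longrightarrow>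
        (\<exists>P. arithmetic_progression (integer_mod_group p) P \<and>
             int (card P) = int (card B) + r \<and> B \<subseteq> P))"

end

theory Submission
  imports Defs
begin

text \<open>
  Apply stability to \<open>A\<close> and \<open>B = A\<close> with \<open>r = k\<^sup>2 - 3k + 1\<close>, which is \<open>o(n)\<close>. If some \<open>c\<close> elements
  \<open>B'\<close> of \<open>A\<close> satisfy \<open>|A + B'| \<ge> 2n + r\<close>, then removing at most \<open>k(k - 1)\<close> forbidden sums leaves
  at least \<open>2n + 1 - 2k\<close> of them. Otherwise \<open>A\<close> lies in a progression of length \<open>n + r \<le> p/2\<close>, so it
  behaves additively like a set of integers, and two elements suffice: if \<open>x\<close> has \<open>i\<close> elements
  of \<open>A\<close> below it and \<open>y\<close> has \<open>j\<close> elements above it, the translates \<open>A + x\<close> and \<open>A + y\<close> meet in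
  at most \<open>i + j + 1\<close> points. It remains to find \<open>x\<close> and \<open>y\<close> with \<open>i + f x + j + f y \<le> 2k - 2\<close>,
  where \<open>f b\<close> counts the forbidden pairs with second coordinate \<open>b\<close>. If there are none, then
  \<open>i + f x \<ge> s\<close> and \<open>j + f y \<ge> t\<close> throughout for some \<open>s + t = 2k - 1\<close>, and the number of forbidden
  pairs is at least \<open>s(s + 1)/2 + t(t + 1)/2 \<ge> k\<^sup>2\<close>.
\<close>

section \<open>Counting: cheap indices near both ends of a sequence\<close>

lemma sum_descending: "2 * (\<Sum>i<s. s - i) = s * (s + 1)" for s :: nat
proof -
  have "(\<Sum>i<s. s - i) = (\<Sum>i<s. Suc (s - Suc i))"
    by (intro sum.cong) (auto simp: Suc_diff_Suc)
  also have "\<dots> = (\<Sum>i<s. Suc i)"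
    by (rule sum.nat_diff_reindex)
  finally have *: "(\<Sum>i<s. s - i) = (\<Sum>i<s. Suc i)" .
  have "2 * (\<Sum>i<s. Suc i) = s * (s + 1)"
    by (induction s) auto
  then show ?thesis using * by simp
qed

text \<open>Each \<open>f i\<close> is at least \<open>s - i\<close>, so the sum dominates s + (s -
  1) + ... + 1.\<close>

lemma sum_ge_descending:
  fixes f :: "nat \<Rightarrow> nat"
  assumes "\<And>i. i < s \<Longrightarrow> s \<le> i + f i"
  shows "s * (s + 1) \<le> 2 * (\<Sum>i<s. f i)"
proof -
  have "(\<Sum>i<s. s - i) \<le> (\<Sum>i<s. f i)"
    using assms by (intro sum_mono) (simp add: le_diff_conv add.commute)
  then show ?thesis
    using sum_descending[of s] by linarith
qed

text \<open>Costs are measured from both ends: \<open>n - 1 - j\<close> is the index with exactly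
  \<open>j\<close> indices after it. The bound on \<open>n\<close> leaves room for the cheap
  stretches at the two ends to be disjoint.\<close>

lemma light_indices:
  fixes f :: "nat \<Rightarrow> nat"
  assumes f: "(\<Sum>i<n. f i) < K * K" and n: "2 * K \<le> n"
  obtains i j where "i < n" "j < n" "i + f i + (j + f (n - 1 - j)) + 2 \<le> 2 * K"
proof -
  have K: "0 < K" using f by (cases K) auto
  have "0 < n" using K n by simp
  \<comment> \<open>\<open>i\<close> and \<open>j\<close> minimise the cost from the left and from
    the right, so the two minima bound every other cost from below.\<close>
  then obtain i where i: "i < n" and i_le: "\<And>i'. i' < n \<Longrightarrow> i + f i \<le> i' + f i'"
    using ex_has_least_nat[of "\<lambda>i. i < n" 0 "\<lambda>i. i + f i"] by blast
  obtain j where j: "j < n"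
    and j_le: "\<And>j'. j' < n \<Longrightarrow> j + f (n - 1 - j) \<le> j' + f (n - 1 - j')"
    using ex_has_least_nat[of "\<lambda>j. j < n" 0 "\<lambda>j. j + f (n - 1 - j)"] \<open>0 < n\<close> by blast
  define s t where "s = i + f i" and "t = j + f (n - 1 - j)"
  have "s + t + 2 \<le> 2 * K"
  proof (rule ccontr)
    assume "\<not> s + t + 2 \<le> 2 * K"
    \<comment> \<open>The minima are lowered until s' + t' = 2K - 1. As this is less than
      \<open>n\<close>, the first s' and the last t' indices are disjoint.\<close>
    then obtain s' t' where st: "s' \<le> s" "t' \<le> t" "s' + t' + 1 = 2 * K"
      by (intro that[of "min s (2 * K - 1)" "2 * K - 1 - min s (2 * K - 1)"]) (use K in auto)
    have "s' * (s' + 1) \<le> 2 * (\<Sum>i<s'. f i)"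
    proof (rule sum_ge_descending)
      fix i' assume "i' < s'"
      then show "s' \<le> i' + f i'"
        using i_le[of i'] st n unfolding s_def by linarith
    qed
    moreover have "t' * (t' + 1) \<le> 2 * (\<Sum>j<t'. f (n - 1 - j))"
    proof (rule sum_ge_descending)
      fix j' assume "j' < t'"
      then show "t' \<le> j' + f (n - 1 - j')"
        using j_le[of j'] st n unfolding t_def by linarith
    qed
    moreover have "(\<Sum>i<s'. f i) + (\<Sum>j<t'. f (n - 1 - j)) \<le> (\<Sum>i<n. f i)"
    proof -
      have inj: "inj_on (\<lambda>j. n - 1 - j) {..<t'}"
        using st n by (auto intro!: inj_onI)
      have "(\<Sum>i<s'. f i) + (\<Sum>j<t'. f (n - 1 - j))
          = sum f {..<s'} + sum f ((\<lambda>j. n - 1 - j) ` {..<t'})"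
        by (simp only: sum.reindex[OF inj] o_def)
      also have "\<dots> = sum f ({..<s'} \<union> (\<lambda>j. n - 1 - j) ` {..<t'})"
        by (rule sum.union_disjoint[symmetric]) (use st n in auto)
      also have "\<dots> \<le> (\<Sum>i<n. f i)"
        by (rule sum_mono2) (use st n in auto)
      finally show ?thesis .
    qed
    moreover have "2 * (K * K) \<le> s' * (s' + 1) + t' * (t' + 1)"
    proof -
      \<comment> \<open>The sum s' + t' is odd, so (s' - t')^2 \<ge> 1. Twice the right-hand side
        equals (s' + t')^2 + (s' - t')^2 + 2(s' + t'), which is at least (2K - 1)^2 + 1 + 2(2K - 1)
        = 4K^2.\<close>
      have "int s' - int t' \<noteq> 0" using st(3) by presburger
      then have "0 < (int s' - int t')\<^sup>2" by simp
      then have "1 \<le> (int s' - int t')\<^sup>2" by linarith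
      moreover have t': "int t' = 2 * int K - 1 - int s'" using st(3) by linarith
      ultimately have "2 * (int K * int K) \<le> int s' * (int s' + 1) + int t' * (int t' + 1)"
        unfolding t' by (simp add: power2_eq_square algebra_simps)
      then have "int (2 * (K * K)) \<le> int (s' * (s' + 1) + t' * (t' + 1))" by (simp add: algebra_simps)
      then show ?thesis by (simp only: of_nat_le_iff)
    qed
    ultimately show False using f by linarith
  qed
  then show ?thesis using that i j by (simp add: s_def t_def)
qed

section \<open>Overlap of two translates\<close>

lemma light_pair:
  fixes S :: "nat set" and f :: "nat \<Rightarrow> nat"
  assumes S: "finite S" "2 * K \<le> card S" and f: "sum f S < K * K"
  obtains x y where "x \<in> S" "y \<in> S"
    "card {z \<in> S. \<exists>w\<in>S. z + x = w + y} + f x + f y + 1 \<le> 2 * K"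
proof -
  let ?n = "card S"
  obtain e where e: "bij_betw e {..<?n} S" and mono: "strict_mono_on {..<?n} e"
    using ex_bij_betw_strict_mono_card[OF S(1)] .
  have "(\<Sum>i<?n. f (e i)) < K * K"
    using f sum.reindex_bij_betw[OF e, of f] by simp
  from light_indices[OF this S(2)]
  obtain i j where ij: "i < ?n" "j < ?n" "i + f (e i) + (j + f (e (?n - 1 - j))) + 2 \<le> 2 * K"
    by metis
  define x y where "x = e i" and "y = e (?n - 1 - j)"
  have xy: "x \<in> S" "y \<in> S"
    using ij e by (auto simp: x_def y_def bij_betw_def)
  have less: "e u < e v \<longleftrightarrow> u < v" if "u < ?n" "v < ?n" for u v
    using strict_mono_on_less[OF mono] that by auto
  \<comment> \<open>The set on the left indexes the overlap of S + x and S + y. Either z \<ge> y,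
    which allows j + 1 values with \<open>y\<close> itself included, or w < x, which allows
    \<open>i\<close> values of \<open>w\<close>, and \<open>w\<close> determines
    \<open>z\<close>.\<close>
  have "{z \<in> S. \<exists>w\<in>S. z + x = w + y} \<subseteq> e ` {?n - 1 - j..<?n} \<union> (\<lambda>w. w + y - x) ` e ` {..<i}"
  proof
    fix z assume "z \<in> {z \<in> S. \<exists>w\<in>S. z + x = w + y}"
    then obtain w where zw: "z \<in> S" "w \<in> S" "z + x = w + y" by auto
    obtain u v where uv: "u < ?n" "z = e u" "v < ?n" "w = e v"
      using zw bij_betw_imp_surj_on[OF e] by (metis imageE lessThan_iff)
    show "z \<in> e ` {?n - 1 - j..<?n} \<union> (\<lambda>w. w + y - x) ` e ` {..<i}"
    proof (cases "z < y")
      case True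
      then have "w < x" using zw by linarith
      then have "v < i" using less ij uv by (auto simp: x_def)
      moreover have "z = w + y - x" using zw by linarith
      ultimately show ?thesis using uv by auto
    next
      case False
      then have "\<not> u < ?n - 1 - j" using less[of u "?n - 1 - j"] ij uv by (auto simp: y_def)
      then show ?thesis using uv by auto
    qed
  qed
  then have "card {z \<in> S. \<exists>w\<in>S. z + x = w + y}
      \<le> card (e ` {?n - 1 - j..<?n} \<union> (\<lambda>w. w + y - x) ` e ` {..<i})"
    by (intro card_mono) auto
  also have "\<dots> \<le> card (e ` {?n - 1 - j..<?n}) + card ((\<lambda>w. w + y - x) ` e ` {..<i})"
    by (rule card_Un_le)
  also have "\<dots> \<le> card {?n - 1 - j..<?n} + card {..<i}"
    unfolding image_image by (intro add_mono card_image_le) auto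
  also have "\<dots> \<le> (j + 1) + i" using ij by simp
  finally show ?thesis using that[OF xy] ij by (simp add: x_def y_def)
qed

text \<open>In the application \<open>g\<close> lists a progression and \<open>S\<close> holds the
  indices of the elements of A. Equal sums in \<open>G\<close> force equal sums of indices, so two
  translates overlap no more than they would in the integers.\<close>

lemma restricted_sum_two_translates:
  assumes S: "finite S" "2 * K \<le> card S"
    and F: "finite F" "card F < K * K"
    and g: "\<And>i j i' j'. \<lbrakk>i \<in> S; j \<in> S; i' \<in> S; j' \<in> S;
      g i \<otimes>\<^bsub>G\<^esub> g j = g i' \<otimes>\<^bsub>G\<^esub> g j'\<rbrakk> \<Longrightarrow> i + j = i' + (j' :: nat)"
  shows "\<exists>B \<subseteq> g ` S. card B \<le> 2 \<and> 2 * card S + 1 \<le> card (restricted_sum G F (g ` S) B) + 2 * K"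
proof -
  have inj: "inj_on g S"
    using g by (metis add_right_cancel inj_onI)
  define f where "f j = card {i \<in> S. (g i, g j) \<in> F}" for j
  have "sum f S = card (SIGMA j:S. {i \<in> S. (g i, g j) \<in> F})"
    unfolding f_def using S by (intro card_SigmaI[symmetric]) auto
  also have "\<dots> \<le> card F"
    by (rule card_inj_on_le[where f = "\<lambda>(j, i). (g i, g j)"])
      (use inj F in \<open>auto simp: inj_on_def\<close>)
  finally have "sum f S < K * K" using F by simp
  from light_pair[OF S this] obtain x y where xy: "x \<in> S" "y \<in> S"
    and le: "card {z \<in> S. \<exists>w\<in>S. z + x = w + y} + f x + f y + 1 \<le> 2 * K" .
  define U where "U x = (\<lambda>i. g i \<otimes>\<^bsub>G\<^esub> g x) ` {i \<in> S. (g i, g x) \<notin> F}" for x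
  have card_U: "card S \<le> card (U x) + f x" and fin_U: "finite (U x)" if "x \<in> S" for x
  proof -
    have "inj_on (\<lambda>i. g i \<otimes>\<^bsub>G\<^esub> g x) {i \<in> S. (g i, g x) \<notin> F}"
      using g[OF _ that _ that] by (intro inj_onI) fastforce
    then have "card (U x) = card {i \<in> S. (g i, g x) \<notin> F}"
      unfolding U_def by (rule card_image)
    also have "{i \<in> S. (g i, g x) \<notin> F} = S - {i \<in> S. (g i, g x) \<in> F}"
      by auto
    finally have "card (U x) = card (S - {i \<in> S. (g i, g x) \<in> F})" .
    then show "card S \<le> card (U x) + f x"
      using S by (simp add: f_def card_Diff_subset)
    show "finite (U x)" using S by (simp add: U_def)
  qed
  have "U x \<inter> U y \<subseteq> (\<lambda>i. g i \<otimes>\<^bsub>G\<^esub> g x) ` {z \<in> S. \<exists>w\<in>S. z + x = w + y}"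
    unfolding U_def using g xy by blast
  then have Int: "card (U x \<inter> U y) \<le> card {z \<in> S. \<exists>w\<in>S. z + x = w + y}"
    using S by (simp add: surj_card_le)
  have restricted_sum_eq: "restricted_sum G F (g ` S) {g x, g y} = U x \<union> U y"
    unfolding restricted_sum_def U_def by auto
  have "card (U x) + card (U y) = card (U x \<union> U y) + card (U x \<inter> U y)"
    using xy by (intro card_Un_Int fin_U)
  then have "2 * card S + 1 \<le> card (restricted_sum G F (g ` S) {g x, g y}) + 2 * K"
    unfolding restricted_sum_eq using card_U[OF xy(1)] card_U[OF xy(2)] Int le by linarith
  moreover have "card {g x, g y} \<le> 2" by (simp add: card_insert_if)
  ultimately show ?thesis using xy by (intro exI[of _ "{g x, g y}"]) auto
qed

section \<open>Short progressions modulo a prime\<close>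

lemma finite_arithmetic_progression:
  assumes "arithmetic_progression G P"
  shows "finite P"
proof -
  obtain a d where "P = {a \<otimes>\<^bsub>G\<^esub> d [^]\<^bsub>G\<^esub> i | i::nat. i < card P}"
    using assms unfolding arithmetic_progression_def by blast
  then have "P = (\<lambda>i::nat. a \<otimes>\<^bsub>G\<^esub> d [^]\<^bsub>G\<^esub> i) ` {..<card P}" by auto
  then show ?thesis by (metis finite_imageI finite_lessThan)
qed

text \<open>Equal sums make (i + j - i' - j') d a multiple of \<open>p\<close>. The step
  \<open>d\<close> is invertible modulo \<open>p\<close>, so \<open>p\<close> divides the index
  difference, which is too small to wrap around because 2 |P| \<le> p.\<close>

lemma arithmetic_progression_Freiman:
  fixes p :: nat
  assumes p: "prime p" and P: "arithmetic_progression (integer_mod_group p) P"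
    and card: "2 \<le> card P" "2 * card P \<le> p"
  obtains g :: "nat \<Rightarrow> int" where "P = g ` {..<card P}"
    "\<And>i j i' j'. \<lbrakk>i < card P; j < card P; i' < card P; j' < card P;
       g i \<otimes>\<^bsub>integer_mod_group p\<^esub> g j = g i' \<otimes>\<^bsub>integer_mod_group p\<^esub> g j'\<rbrakk> \<Longrightarrow> i + j = i' + j'"
proof -
  obtain a d where P: "P = {a \<otimes>\<^bsub>integer_mod_group p\<^esub> d [^]\<^bsub>integer_mod_group p\<^esub> i | i::nat. i < card P}"
    using P unfolding arithmetic_progression_def by blast
  define g where "g i = (a + int i * d) mod int p" for i :: nat
  have Pg: "P = g ` {..<card P}"
    by (subst P) (auto simp: g_def mod_simps)
  \<comment> \<open>A step divisible by \<open>p\<close> would collapse the progression to one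
    point.\<close>
  have "\<not> int p dvd d"
  proof
    assume "int p dvd d"
    then have "g ` {..<card P} \<subseteq> {a mod int p}"
      by (auto simp: g_def mod_eq_dvd_iff)
    then have "card P \<le> card {a mod int p}"
      using Pg by (metis card_mono finite.emptyI finite.insertI)
    then show False using card by simp
  qed
  then have coprime: "coprime (int p) d"
    using p by (simp add: prime_imp_coprime)
  have "i + j = i' + j'"
    if "i < card P" "j < card P" "i' < card P" "j' < card P"
      "g i \<otimes>\<^bsub>integer_mod_group p\<^esub> g j = g i' \<otimes>\<^bsub>integer_mod_group p\<^esub> g j'" for i j i' j'
  proof -
    have "(a + int i * d + (a + int j * d)) mod int p = (a + int i' * d + (a + int j' * d)) mod int p"
      using that(5) by (simp add: g_def mod_simps)
    then have "int p dvd (int (i + j) - int (i' + j')) * d"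
      by (simp add: mod_eq_dvd_iff algebra_simps)
    then have "int p dvd int (i + j) - int (i' + j')"
      using coprime by (simp add: coprime_dvd_mult_left_iff)
    moreover have "\<bar>int (i + j) - int (i' + j')\<bar> < int p"
      using that(1-4) card by linarith
    ultimately have "int (i + j) - int (i' + j') = 0"
      using dvd_imp_le_int[of "int (i + j) - int (i' + j')" "int p"] by linarith
    then show ?thesis by linarith
  qed
  then show ?thesis using that Pg by blast
qed

section \<open>Loss from forbidden pairs, and the growth of k\<close>

lemma card_set_mult_le_restricted_sum:
  assumes "finite A" "finite B" "finite F"
  shows "card (A <#>\<^bsub>G\<^esub> B) \<le> card (restricted_sum G F A B) + card F"
proof -
  have "restricted_sum G F A B \<subseteq> A <#>\<^bsub>G\<^esub> B"
    by (auto simp: restricted_sum_def set_mult_def)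
  moreover have "finite (A <#>\<^bsub>G\<^esub> B)"
    using assms by (simp add: set_mult_def)
  ultimately have fin: "finite (restricted_sum G F A B)"
    by (rule finite_subset)
  have "A <#>\<^bsub>G\<^esub> B \<subseteq> restricted_sum G F A B \<union> (\<lambda>(a, b). a \<otimes>\<^bsub>G\<^esub> b) ` F"
    by (force simp: restricted_sum_def set_mult_def)
  then have "card (A <#>\<^bsub>G\<^esub> B) \<le> card (restricted_sum G F A B \<union> (\<lambda>(a, b). a \<otimes>\<^bsub>G\<^esub> b) ` F)"
    using fin assms by (intro card_mono) auto
  also have "\<dots> \<le> card (restricted_sum G F A B) + card ((\<lambda>(a, b). a \<otimes>\<^bsub>G\<^esub> b) ` F)"
    by (rule card_Un_le)
  also have "\<dots> \<le> card (restricted_sum G F A B) + card F"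
    using assms by (simp add: card_image_le)
  finally show ?thesis .
qed

lemma smallo_sqrt_square_bound:
  assumes "(\<lambda>n. real_of_int (k n)) \<in> o(\<lambda>n. sqrt (real n))" "0 < \<delta>"
  shows "\<forall>\<^sub>F n in sequentially. (real_of_int (k n))\<^sup>2 \<le> \<delta> * real n"
proof -
  have "\<forall>\<^sub>F n in sequentially. norm (real_of_int (k n)) \<le> sqrt \<delta> * norm (sqrt (real n))"
    using landau_o.smallD[OF assms(1), of "sqrt \<delta>"] assms(2) by simp
  then show ?thesis
  proof eventually_elim
    case (elim n)
    then have "\<bar>real_of_int (k n)\<bar>\<^sup>2 \<le> (sqrt \<delta> * sqrt (real n))\<^sup>2"
      by (intro power_mono) auto
    then show ?case using assms(2) by (simp add: power_mult_distrib)
  qed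
qed

theorem theorem36:
  fixes k :: "nat \<Rightarrow> int" and \<beta> \<epsilon> :: real and c :: nat
  assumes "\<And>n. 2 \<le> k n"
    and "(\<lambda>n. real_of_int (k n)) \<in> o(\<lambda>n. sqrt (real n))"
    and "0 < \<beta>" and "\<beta> < 1/2"
    and "2 \<le> c"
    and "0 < \<epsilon>" and "\<epsilon> < 1/2"
    and "stability 1 \<beta> c \<epsilon>"
  shows "\<forall>\<^sub>F n in sequentially.
           \<forall>(p::nat) A F.
             prime p \<longrightarrow>
             A \<subseteq> carrier (integer_mod_group p) \<longrightarrow>
             card A = n \<longrightarrow>
             real n < (1 - \<beta>) * real p / 2 \<longrightarrow>
             F \<subseteq> A \<times> A \<longrightarrow>
             int (card F) \<le> k n * (k n - 1) \<longrightarrow>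
             (\<exists>B'. B' \<subseteq> A \<and> card B' \<le> c \<and>
                   int (card (restricted_sum (integer_mod_group p) F A B'))
                     \<ge> 2 * int n + 1 - 2 * k n)"
proof -
  \<comment> \<open>The bound k^2 \<le> \<epsilon> n makes \<open>r\<close> admissible for
    stability; k^2 \<le> \<beta> n keeps the progression within length p/2.\<close>
  have "0 < min \<beta> \<epsilon>" using assms by simp
  from smallo_sqrt_square_bound[OF assms(2) this] eventually_ge_at_top[of 2]
  show ?thesis
  proof eventually_elim
    case (elim n)
    have k: "2 \<le> k n" by fact
    \<comment> \<open>Chosen so that 2n + r - k(k - 1) is exactly 2n + 1 - 2k. For k = 2 it is -1,
      which \<open>stability\<close> allows.\<close>
    define r where "r = k n * k n - 3 * k n + 1"
    have kk: "2 * k n \<le> k n * k n" using k by (intro mult_right_mono) auto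
    have "(real_of_int (k n))\<^sup>2 \<le> \<beta> * real n" "(real_of_int (k n))\<^sup>2 \<le> \<epsilon> * real n"
      using elim(1) by (smt (verit) mult_right_mono of_nat_0_le_iff)+
    then have k\<beta>: "real_of_int (k n * k n) \<le> \<beta> * real n"
      and k\<epsilon>: "real_of_int (k n * k n) \<le> \<epsilon> * real n"
      by (simp_all add: power2_eq_square)
    have r_le: "r \<le> k n * k n" unfolding r_def using k by linarith
    show ?case
    proof (intro allI impI)
      fix p :: nat and A F
      assume p: "prime p" and A: "A \<subseteq> carrier (integer_mod_group p)" "card A = n"
        and np: "real n < (1 - \<beta>) * real p / 2"
        and F: "F \<subseteq> A \<times> A" "int (card F) \<le> k n * (k n - 1)"
      let ?G = "integer_mod_group p"
      have finA: "finite A" using A elim(2) by (intro card_ge_0_finite) simp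
      then have finF: "finite F" using F by (meson finite_SigmaI finite_subset)
      show "\<exists>B'. B' \<subseteq> A \<and> card B' \<le> c \<and>
          int (card (restricted_sum ?G F A B')) \<ge> 2 * int n + 1 - 2 * k n"
      proof (cases "\<forall>b \<in> {1..c} \<rightarrow> A. int (card (A <#>\<^bsub>?G\<^esub> (b ` {1..c}))) \<le> int n + int n - 1 + r")
        case False
        then obtain b where b: "b \<in> {1..c} \<rightarrow> A"
          and "int (card (A <#>\<^bsub>?G\<^esub> (b ` {1..c}))) \<ge> 2 * int n + r" by force
        moreover have "card (A <#>\<^bsub>?G\<^esub> (b ` {1..c}))
            \<le> card (restricted_sum ?G F A (b ` {1..c})) + card F"
          using finA finF by (intro card_set_mult_le_restricted_sum) auto
        ultimately have "int (card (restricted_sum ?G F A (b ` {1..c}))) \<ge> 2 * int n + 1 - 2 * k n"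
          using F(2) by (simp add: r_def algebra_simps)
        moreover have "card (b ` {1..c}) \<le> c"
          using card_image_le[of "{1..c}" b] by simp
        ultimately show ?thesis using b by blast
      next
        case True
        have "real_of_int r \<le> \<epsilon> * real n"
          using k\<epsilon> r_le by linarith
        moreover have "real n + real n \<le> (1 - \<beta>) * real p" using np by simp
        ultimately obtain P where P: "arithmetic_progression ?G P"
          and cardP: "int (card P) = int n + r" and AP: "A \<subseteq> P"
          using assms(8)[unfolded stability_def, rule_format, of p A A r] p A elim(2) True by auto
        \<comment> \<open>From 2n \<le> p follows 2r \<le> 2 \<beta> n \<le> \<beta> p, which is the
          slack left by 2n < (1 - \<beta>) p.\<close>
        have "(1 - \<beta>) * real p \<le> 1 * real p"
          using assms(3) by (intro mult_right_mono) auto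
        then have "2 * real n \<le> real p" using np by simp
        then have "\<beta> * (2 * real n) \<le> \<beta> * real p"
          using assms(3) by (intro mult_left_mono) auto
        moreover have "2 * real n < real p - \<beta> * real p"
          using np by (simp add: left_diff_distrib)
        ultimately have "2 * real n + 2 * real_of_int r \<le> real p"
          using k\<beta> r_le by linarith
        then have "2 * card P \<le> p" using cardP by linarith
        moreover have "2 \<le> card P" using card_mono[OF finite_arithmetic_progression[OF P] AP] A elim(2) by linarith
        ultimately obtain g where Pg: "P = g ` {..<card P}"
          and g: "\<And>i j i' j'. \<lbrakk>i < card P; j < card P; i' < card P; j' < card P;
            g i \<otimes>\<^bsub>?G\<^esub> g j = g i' \<otimes>\<^bsub>?G\<^esub> g j'\<rbrakk> \<Longrightarrow> i + j = i' + j'"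
          using arithmetic_progression_Freiman[OF p P] by metis
        define S where "S = {i. i < card P \<and> g i \<in> A}"
        have Ag: "A = g ` S" using AP Pg by (auto simp: S_def)
        have inj: "inj_on g S"
          using g unfolding S_def by (intro inj_onI) (metis (mono_tags, lifting) add_right_cancel mem_Collect_eq)
        have cardS: "card S = n" using A(2) Ag inj by (simp add: card_image)
        \<comment> \<open>Here 2k \<le> k^2 \<le> \<epsilon> n \<le> n, the room required by the
          counting argument.\<close>
        have "2 * k n \<le> int n"
        proof -
          have "\<epsilon> * real n \<le> 1 * real n" using assms(7) by (intro mult_right_mono) auto
          then show ?thesis using k\<epsilon> kk by linarith
        qed
        then have "2 * nat (k n) \<le> card S" using cardS by linarith
        moreover have "card F < nat (k n) * nat (k n)"
        proof -
          have "int (card F) < k n * k n" using F(2) k by (simp add: algebra_simps)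
          then show ?thesis using k by (simp add: nat_mult_distrib[symmetric] zless_nat_eq_int_zless)
        qed
        ultimately have "\<exists>B \<subseteq> g ` S. card B \<le> 2 \<and>
            2 * card S + 1 \<le> card (restricted_sum ?G F (g ` S) B) + 2 * nat (k n)"
          using finF g by (intro restricted_sum_two_translates) (auto simp: S_def)
        then obtain B where B: "B \<subseteq> A" "card B \<le> 2"
          "2 * n + 1 \<le> card (restricted_sum ?G F A B) + 2 * nat (k n)"
          unfolding Ag[symmetric] cardS by blast
        then show ?thesis using assms(5) k by (intro exI[of _ B]) linarith
      qed
    qed
  qed
qed

end
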